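(* Let $\mathbb{F}$ be a field and let $f\in\mathbb{F}[x_1,\dots,x_n]$ be a polynomial of (total) degree $\sum_{i=1}^n t_i$, where each $t_i$ is a nonnegative integer. Assume that the coefficient in $f$ of the monomial $x_1^{t_1}x_2^{t_2}\cdots x_n^{t_n}$ is nonzero. Suppose further that $(S_1,m_1),\dots,(S_n,m_n)$ are finite multisets of elements of $\mathbb{F}$ such that the size $d_i$ of $(S_i,m_i)$ satisfies $d_i>t_i$ for $i=1,\dots,n$. Then $f$ is not in the ideal $I=\bigcap_{\mathbf{s}\in S_1\times\cdots\times S_n}I(\mathbf{s},m(\mathbf{s}))$. In other words, there exist a point $\mathbf{s}=(s_1,\dots,s_n)\in S_1\times\cdots\times S_n$ and an exponent vector $\mathbf{u}=(u_1,\dots,u_n)$ of nonnegative integers with $u_i<m_i(s_i)$ for each $i$, such that $f_{\mathbf{u}}(\mathbf{s})\neq 0$ in the expansion $$f(x_1,\dots,x_n)=\sum_{\mathbf{u}} f_{\mathbf{u}}(\mathbf{s})(\mathbf{x}-\mathbf{s})^{\mathbf{u}},\qquad f_{\mathbf{u}}(\mathbf{s})\in\mathbb{F}.$$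
   Context: A finite multiset $(S_i,m_i)$ of elements of $\mathbb{F}$ is a finite subset $S_i\subseteq\mathbb{F}$ together with a positive integer multiplicity $m_i(s)$ for each $s\in S_i$. Its size is $d_i=\sum_{s\in S_i}m_i(s)$. For $\mathbf{s}=(s_1,\dots,s_n)\in S_1\times\cdots\times S_n$ put $m(\mathbf{s})=(m_1(s_1),\dots,m_n(s_n))$. $\mathbb{N}$ is the set of nonnegative integers. For $\mathbf{s}\in\mathbb{F}^n$ and $\mathbf{u}\in\mathbb{N}^n$, $(\mathbf{x}-\mathbf{s})^{\mathbf{u}}=\prod_{i=1}^n(x_i-s_i)^{u_i}$. Every $f\in\mathbb{F}[x_1,\dots,x_n]$ has a unique expansion $f(\mathbf{x})=\sum_{\mathbf{u}\in\mathbb{N}^n}f_{\mathbf{u}}(\mathbf{s})(\mathbf{x}-\mathbf{s})^{\mathbf{u}}$ with $f_{\mathbf{u}}(\mathbf{s})\in\mathbb{F}$. For a vector $\mathbf{w}$ of positive integers, $I(\mathbf{s},\mathbf{w})$ is the ideal of all $f$ with $f_{\mathbf{u}}(\mathbf{s})=0$ for all $\mathbf{u}<\mathbf{w}$, where $\mathbf{u}<\mathbf{w}$ means $u_i<w_i$ for every $i$. *)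

theory Defs
  imports "HOL-Library.Poly_Mapping" "HOL-Library.Multiset" "HOL-Library.FuncSet"
begin

text \<open>
  The variables are indexed by a finite type \<open>'n\<close>, so that \<open>n = CARD('n)\<close>.
  An exponent vector is a map \<open>'n \<Rightarrow>\<^sub>0 nat\<close> (finite support is no restriction),
  and a polynomial is the finitely supported map sending an exponent vector to its coefficient.
  The ring structure is the convolution product of \<open>HOL-Library.Poly_Mapping\<close>.
\<close>

type_synonym ('n, 'a) mpoly = "('n \<Rightarrow>\<^sub>0 nat) \<Rightarrow>\<^sub>0 'a"

definition mconst :: "'a \<Rightarrow> ('n, 'a::zero) mpoly" where
  "mconst c = Poly_Mapping.single 0 c"

definition mvar :: "'n \<Rightarrow> ('n, 'a::zero_neq_one) mpoly" where
  "mvar i = Poly_Mapping.single (Poly_Mapping.single i 1) 1"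

abbreviation mcoeff :: "('n, 'a::zero) mpoly \<Rightarrow> ('n \<Rightarrow>\<^sub>0 nat) \<Rightarrow> 'a" where
  "mcoeff f u \<equiv> Poly_Mapping.lookup f u"

text \<open>By convention the zero polynomial has total degree 0.\<close>

definition total_degree :: "('n::finite, 'a::zero) mpoly \<Rightarrow> nat" where
  "total_degree f =
     Max (insert 0 ((\<lambda>u. \<Sum>i\<in>UNIV. Poly_Mapping.lookup u i) ` Poly_Mapping.keys f))"

definition shifted_monomial ::
    "('n::finite \<Rightarrow> 'a::comm_ring_1) \<Rightarrow> ('n \<Rightarrow>\<^sub>0 nat) \<Rightarrow> ('n, 'a) mpoly" where
  "shifted_monomial s u = (\<Prod>i\<in>UNIV. (mvar i - mconst (s i)) ^ Poly_Mapping.lookup u i)"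

text \<open>
  A finitely supported family \<open>c\<close> of coefficients, indexed by exponent vectors, has the same type
  as a polynomial. \<open>shifted_sum s c\<close> is the sum of all \<open>c\<^sub>u (x - s)\<^sup>u\<close>.
\<close>

definition shifted_sum ::
    "('n::finite \<Rightarrow> 'a::comm_ring_1) \<Rightarrow> (('n \<Rightarrow>\<^sub>0 nat) \<Rightarrow>\<^sub>0 'a) \<Rightarrow> ('n, 'a) mpoly" where
  "shifted_sum s c =
     (\<Sum>u\<in>Poly_Mapping.keys c. mconst (Poly_Mapping.lookup c u) * shifted_monomial s u)"

definition shifted_coeff ::
    "('n, 'a) mpoly \<Rightarrow> ('n::finite \<Rightarrow> 'a::comm_ring_1) \<Rightarrow> ('n \<Rightarrow>\<^sub>0 nat) \<Rightarrow> 'a" where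
  "shifted_coeff f s = Poly_Mapping.lookup (THE c. f = shifted_sum s c)"

definition vanishing_ideal ::
    "('n::finite \<Rightarrow> 'a::comm_ring_1) \<Rightarrow> ('n \<Rightarrow> nat) \<Rightarrow> ('n, 'a) mpoly set" where
  "vanishing_ideal s w =
     {f. \<forall>u. (\<forall>i. Poly_Mapping.lookup u i < w i) \<longrightarrow> shifted_coeff f s u = 0}"


text \<open>The expansion exists and is unique, so the definite description above is meaningful.\<close>

lemma mconst_0: "mconst 0 = 0" and mconst_1: "mconst 1 = 1"
  and mconst_add: "mconst (a + b) = mconst a + mconst b"
  and mconst_mult: "mconst (a * b) = mconst a * mconst (b::'a::comm_ring_1)"
  and mconst_uminus: "mconst (- a) = - mconst a"
  by (simp_all add: mconst_def single_add mult_single single_uminus)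

lemma mpoly_eq_sum_single:
  "(f::('n, 'a::comm_ring_1) mpoly)
     = (\<Sum>u\<in>Poly_Mapping.keys f. Poly_Mapping.single u (mcoeff f u))"
proof (rule poly_mapping_eqI)
  fix k
  show "mcoeff f k = mcoeff (\<Sum>u\<in>Poly_Mapping.keys f. Poly_Mapping.single u (mcoeff f u)) k"
    by (simp add: lookup_sum lookup_single when_def sum.delta in_keys_iff)
qed

lemma shifted_sum_superset:
  assumes "finite A" "Poly_Mapping.keys c \<subseteq> A"
  shows "shifted_sum s c = (\<Sum>u\<in>A. mconst (Poly_Mapping.lookup c u) * shifted_monomial s u)"
  unfolding shifted_sum_def using assms
  by (intro sum.mono_neutral_left) (auto simp: in_keys_iff mconst_0)

lemma shifted_sum_0 [simp]: "shifted_sum s 0 = 0"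
  by (simp add: shifted_sum_def)

lemma shifted_sum_add: "shifted_sum s (c + d) = shifted_sum s c + shifted_sum s d"
proof -
  let ?A = "Poly_Mapping.keys c \<union> Poly_Mapping.keys d"
  have "Poly_Mapping.keys (c + d) \<subseteq> ?A" by (rule Poly_Mapping.keys_add)
  then show ?thesis
    by (simp add: shifted_sum_superset[of ?A] lookup_add mconst_add distrib_right sum.distrib)
qed

lemma shifted_sum_sum: "shifted_sum s (\<Sum>x\<in>A. g x) = (\<Sum>x\<in>A. shifted_sum s (g x))"
  by (induction A rule: infinite_finite_induct) (simp_all add: shifted_sum_add)

lemma shifted_sum_single:
  "shifted_sum s (Poly_Mapping.single u c) = mconst c * shifted_monomial s u"
  by (subst shifted_sum_superset[of "{u}"]) (auto)

lemma shifted_monomial_add: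
  "shifted_monomial s (u + v) = shifted_monomial s u * shifted_monomial s v"
  by (simp add: shifted_monomial_def lookup_add power_add prod.distrib)

lemma shifted_monomial_0: "shifted_monomial s 0 = 1"
  by (simp add: shifted_monomial_def)

lemma shifted_sum_mult: "shifted_sum s (c * d) = shifted_sum s c * shifted_sum s d"
proof -
  have "c * d = (\<Sum>u\<in>Poly_Mapping.keys c. \<Sum>v\<in>Poly_Mapping.keys d.
                   Poly_Mapping.single (u + v) (mcoeff c u * mcoeff d v))"
    by (subst mpoly_eq_sum_single[of c], subst mpoly_eq_sum_single[of d])
       (simp add: sum_product mult_single)
  then show ?thesis
    by (simp add: shifted_sum_sum shifted_sum_single mconst_mult shifted_monomial_add
        shifted_sum_def[of s c] shifted_sum_def[of s d] sum_product mult_ac)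
qed

lemma shifted_sum_mconst: "shifted_sum s (mconst c) = mconst c"
  unfolding mconst_def by (simp add: shifted_sum_single shifted_monomial_0 mconst_def)

lemma shifted_sum_1: "shifted_sum s 1 = 1"
  using shifted_sum_mconst[of s 1] by (simp only: mconst_1)

lemma shifted_sum_power: "shifted_sum s (c ^ k) = shifted_sum s c ^ k"
  by (induction k) (simp_all add: shifted_sum_mult shifted_sum_1)

lemma shifted_sum_prod: "shifted_sum s (\<Prod>x\<in>A. g x) = (\<Prod>x\<in>A. shifted_sum s (g x))"
  by (induction A rule: infinite_finite_induct) (simp_all add: shifted_sum_mult shifted_sum_1)

lemma shifted_sum_mvar: "shifted_sum s (mvar i) = mvar i - mconst (s i)"
proof -
  have "shifted_monomial s (Poly_Mapping.single i 1)
      = (\<Prod>j\<in>UNIV. if j = i then mvar j - mconst (s j) else 1)"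
    unfolding shifted_monomial_def by (rule prod.cong) (auto simp: lookup_single when_def)
  then show ?thesis
    by (simp add: mvar_def[of i] shifted_sum_single mconst_1)
qed

lemma prod_mvar_power:
  "(\<Prod>i\<in>UNIV. mvar i ^ Poly_Mapping.lookup u i) = Poly_Mapping.single u (1::'a::comm_ring_1)"
  for u :: "'n::finite \<Rightarrow>\<^sub>0 nat"
proof -
  have pow: "(mvar i :: ('n, 'a) mpoly) ^ k
      = Poly_Mapping.single (Poly_Mapping.single i k) 1" for i k
    by (induction k) (simp_all add: mvar_def mult_single single_add[symmetric])
  have "(\<Prod>i\<in>A. (mvar i :: ('n, 'a) mpoly) ^ Poly_Mapping.lookup u i)
      = Poly_Mapping.single (\<Sum>i\<in>A. Poly_Mapping.single i (Poly_Mapping.lookup u i)) 1" for A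
    by (induction A rule: infinite_finite_induct) (simp_all add: pow mult_single)
  moreover have "(\<Sum>i\<in>UNIV. Poly_Mapping.single i (Poly_Mapping.lookup u i)) = u"
    by (rule poly_mapping_eqI) (simp add: lookup_sum lookup_single when_def sum.delta)
  ultimately show ?thesis by simp
qed

lemma shifted_sum_inverse: "shifted_sum (\<lambda>i. - s i) (shifted_sum s c) = c"
proof -
  have neg: "shifted_sum (\<lambda>i. - s i) (- mconst a) = - mconst a" for a
    using shifted_sum_mconst[of _ "- a"] by (simp add: mconst_uminus)
  have "shifted_sum (\<lambda>i. - s i) (mvar i - mconst (s i)) = mvar i" for i
    using shifted_sum_add[of "\<lambda>i. - s i" "mvar i" "- mconst (s i)"]
    by (simp add: shifted_sum_mvar neg mconst_uminus)
  then have "shifted_sum (\<lambda>i. - s i) (shifted_monomial s u) = Poly_Mapping.single u 1" for u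
    by (simp add: shifted_monomial_def shifted_sum_prod shifted_sum_power prod_mvar_power)
  then have "shifted_sum (\<lambda>i. - s i) (shifted_sum s c)
      = (\<Sum>u\<in>Poly_Mapping.keys c. Poly_Mapping.single u (mcoeff c u))"
    by (simp add: shifted_sum_def[of s] shifted_sum_sum shifted_sum_mult shifted_sum_mconst)
       (simp add: mconst_def mult_single)
  then show ?thesis by (simp add: mpoly_eq_sum_single[symmetric])
qed

lemma shifted_sum_unique_existence: "\<exists>!c. f = shifted_sum s c"
proof
  show "f = shifted_sum s (shifted_sum (\<lambda>i. - s i) f)"
    using shifted_sum_inverse[of "\<lambda>i. - s i" f] by simp
next
  fix c assume "f = shifted_sum s c"
  then show "c = shifted_sum (\<lambda>i. - s i) f" by (simp add: shifted_sum_inverse)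
qed

lemma shifted_coeff_eq: "shifted_coeff (shifted_sum s c) s = Poly_Mapping.lookup c"
proof -
  have "(THE d. shifted_sum s c = shifted_sum s d) = c"
    using shifted_sum_unique_existence[of "shifted_sum s c" s] by (intro the1_equality) auto
  then show ?thesis by (simp add: shifted_coeff_def)
qed

end

theory Submission
  imports Defs
begin

text \<open>
  The proof exhibits the coefficient \<open>f\<^sub>t\<close> as a linear combination of the Taylor coefficients
  \<open>f\<^sub>u(s)\<close> with \<open>u < m(s)\<close>; since \<open>f\<^sub>t\<close> is nonzero, so is one of them.

  In one variable, consider the linear functionals on \<open>F[x]\<close> spanned by the maps taking a
  polynomial to its Taylor coefficient of order \<open>j\<close> at \<open>s\<close>, with \<open>j\<close> less than the multiplicity of
  \<open>s\<close> in a multiset \<open>M\<close>. If \<open>M\<close> has more than \<open>t\<close> elements, then this span contains a functional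
  that kills \<open>1, x, \<dots>, x\<^sup>t\<^sup>-\<^sup>1\<close> and takes \<open>x\<^sup>t\<close> to \<open>1\<close>: the divided difference at \<open>t + 1\<close> nodes
  from \<open>M\<close> (lemma \<open>extracting_functional\<close>). It is built by adjoining one node at a time. The
  functional \<open>\<Phi>\<close> for \<open>M\<close> together with a new node \<open>a\<close> is required to satisfy
  \<open>\<Phi>((x - a) p) = \<Psi>(p)\<close>, where \<open>\<Psi>\<close> is the one for \<open>M\<close>, and \<open>\<Phi>(1) = 0\<close>
  (lemma \<open>hermite_functional_lift\<close>). The construction divides only by differences of distinct
  nodes, and Taylor coefficients take the place of derivatives, so it works in every
  characteristic.

  In several variables, apply the tensor product of these functionals, one for each variable and
  with the exponent \<open>t\<^sub>i\<close>. It takes \<open>x\<^sup>v\<close> to the product over \<open>i\<close> of the values of the factors at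
  the \<open>v\<^sub>i\<close>-th power of the variable.
  A monomial \<open>x\<^sup>v\<close> of \<open>f\<close> other than \<open>x\<^sup>t\<close> has degree at most the sum of the \<open>t\<^sub>i\<close>, so \<open>v\<^sub>i < t\<^sub>i\<close>
  for some \<open>i\<close> and the product vanishes. Thus the value at \<open>f\<close> is \<open>f\<^sub>t\<close>. On the other hand the
  tensor product of Taylor coefficient functionals at \<open>s\<^sub>i\<close> of order \<open>u\<^sub>i\<close> takes \<open>f\<close> to \<open>f\<^sub>u(s)\<close>
  (lemma \<open>shifted_coeff_expand\<close>), so this value is a combination of the allowed coefficients.
\<close>

section \<open>Functionals on univariate polynomials\<close>

text \<open>
  A linear functional on \<open>F[x]\<close> is represented by the sequence of its values at the powers of \<open>x\<close>.
  The following sequence takes \<open>k\<close> to the coefficient of \<open>(x - s)\<^sup>j\<close> in the expansion of \<open>x\<^sup>k\<close>.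
\<close>

definition taylor_moment :: "'a::comm_ring_1 \<Rightarrow> nat \<Rightarrow> nat \<Rightarrow> 'a" where
  "taylor_moment s j k = of_nat (k choose j) * s ^ (k - j)"

definition taylor_nodes :: "'a multiset \<Rightarrow> ('a \<times> nat) set" where
  "taylor_nodes M = (SIGMA s:set_mset M. {..<count M s})"

definition hermite_functional :: "'a::comm_ring_1 multiset \<Rightarrow> (nat \<Rightarrow> 'a) \<Rightarrow> bool" where
  "hermite_functional M \<phi> \<longleftrightarrow>
     (\<exists>c. \<forall>k. \<phi> k = (\<Sum>p\<in>taylor_nodes M. c p * taylor_moment (fst p) (snd p) k))"

lemma finite_taylor_nodes [simp]: "finite (taylor_nodes M)"
  by (simp add: taylor_nodes_def)

lemma mem_taylor_nodes: "(s, j) \<in> taylor_nodes M \<longleftrightarrow> j < count M s"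
  by (auto simp: taylor_nodes_def simp flip: count_greater_zero_iff)

lemma taylor_moment_0: "taylor_moment s 0 k = s ^ k"
  by (simp add: taylor_moment_def)

lemma taylor_moment_Suc_0:
  "taylor_moment s 0 (Suc k) - a * taylor_moment s 0 k = (s - a) * taylor_moment s 0 k"
  by (simp add: taylor_moment_def algebra_simps)

text \<open>
  The coefficient of \<open>(x - s)\<^sup>j\<^sup>+\<^sup>1\<close> in \<open>(x - a) p\<close>, for \<open>p = x\<^sup>k\<close>, read off from
  \<open>x - a = (x - s) + (s - a)\<close>.
\<close>

lemma taylor_moment_Suc_Suc:
  "taylor_moment s (Suc j) (Suc k) - a * taylor_moment s (Suc j) k
     = taylor_moment s j k + (s - a) * taylor_moment s (Suc j) k"
proof (cases "j < k")
  case True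
  then have "s ^ (k - j) = s * s ^ (k - Suc j)"
    by (metis Suc_diff_Suc power_Suc)
  then show ?thesis by (simp add: taylor_moment_def algebra_simps)
next
  case False
  then show ?thesis by (simp add: taylor_moment_def binomial_eq_0)
qed

lemma hermite_functional_scale:
  assumes "hermite_functional M \<phi>"
  shows "hermite_functional M (\<lambda>k. b * \<phi> k)"
proof -
  obtain c where "\<And>k. \<phi> k = (\<Sum>p\<in>taylor_nodes M. c p * taylor_moment (fst p) (snd p) k)"
    using assms by (auto simp: hermite_functional_def)
  then show ?thesis unfolding hermite_functional_def
    by (intro exI[of _ "\<lambda>p. b * c p"]) (simp add: sum_distrib_left mult.assoc)
qed

lemma hermite_functional_add:
  assumes "hermite_functional M \<phi>" "hermite_functional M \<psi>"
  shows "hermite_functional M (\<lambda>k. \<phi> k + \<psi> k)"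
proof -
  obtain c d where "\<And>k. \<phi> k = (\<Sum>p\<in>taylor_nodes M. c p * taylor_moment (fst p) (snd p) k)"
    "\<And>k. \<psi> k = (\<Sum>p\<in>taylor_nodes M. d p * taylor_moment (fst p) (snd p) k)"
    using assms by (auto simp: hermite_functional_def)
  then show ?thesis unfolding hermite_functional_def
    by (intro exI[of _ "\<lambda>p. c p + d p"]) (simp add: sum.distrib distrib_right)
qed

lemma hermite_functional_diff:
  assumes "hermite_functional M \<phi>" "hermite_functional M \<psi>"
  shows "hermite_functional M (\<lambda>k. \<phi> k - \<psi> k)"
  using hermite_functional_add[OF assms(1) hermite_functional_scale[OF assms(2), of "-1"]] by simp

lemma hermite_functional_sum:
  assumes "\<And>p. p \<in> A \<Longrightarrow> hermite_functional M (\<phi> p)"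
  shows "hermite_functional M (\<lambda>k. \<Sum>p\<in>A. \<phi> p k)"
  using assms
proof (induction A rule: infinite_finite_induct)
  case (insert p A)
  then show ?case by (simp add: hermite_functional_add)
qed (auto simp: hermite_functional_def intro!: exI[of _ "\<lambda>_. 0"])

lemma hermite_functional_taylor_moment:
  assumes "j < count M s"
  shows "hermite_functional M (taylor_moment s j)"
  unfolding hermite_functional_def
  using assms
  by (intro exI[of _ "\<lambda>p. if p = (s, j) then 1 else 0"])
     (simp add: if_distrib[of "\<lambda>x. x * _"] mem_taylor_nodes cong: if_cong)

section \<open>Divided differences with repeated nodes\<close>

text \<open>
  At a point \<open>s \<noteq> a\<close> the factor \<open>x - a\<close> is a unit modulo powers of \<open>x - s\<close>, so multiplication by
  \<open>x - a\<close> can be undone by recursion on the order. At \<open>a\<close> itself the factor \<open>x - a\<close> only shifts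
  the order by one, and undoing it uses up the additional multiplicity.
\<close>

lemma taylor_moment_lift:
  fixes a s :: "'a::field"
  assumes "j < count M s"
  shows "\<exists>\<phi>. hermite_functional (add_mset a M) \<phi> \<and>
           (\<forall>k. \<phi> (Suc k) - a * \<phi> k = taylor_moment s j k)"
proof (cases "s = a")
  case True
  have "hermite_functional (add_mset a M) (taylor_moment a (Suc j))"
    using assms True by (intro hermite_functional_taylor_moment) simp
  moreover have "taylor_moment a (Suc j) (Suc k) - a * taylor_moment a (Suc j) k
      = taylor_moment s j k" for k
    using taylor_moment_Suc_Suc[of a j k a] True by simp
  ultimately show ?thesis by blast
next
  case False
  then have nz: "s - a \<noteq> 0" by simp
  show ?thesis using assms
  proof (induction j)
    case 0
    have "hermite_functional (add_mset a M) (\<lambda>k. inverse (s - a) * taylor_moment s 0 k)"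
      using 0 by (intro hermite_functional_scale hermite_functional_taylor_moment) simp
    moreover have "inverse (s - a) * taylor_moment s 0 (Suc k)
        - a * (inverse (s - a) * taylor_moment s 0 k) = taylor_moment s 0 k" for k
    proof -
      have "inverse (s - a) * taylor_moment s 0 (Suc k)
          - a * (inverse (s - a) * taylor_moment s 0 k)
          = inverse (s - a) * (taylor_moment s 0 (Suc k) - a * taylor_moment s 0 k)"
        by (simp add: algebra_simps)
      then show ?thesis using nz by (simp add: taylor_moment_Suc_0)
    qed
    ultimately show ?case by blast
  next
    case (Suc j)
    then obtain \<phi> where \<phi>: "hermite_functional (add_mset a M) \<phi>"
      "\<And>k. \<phi> (Suc k) - a * \<phi> k = taylor_moment s j k" by fastforce
    let ?\<phi>' = "\<lambda>k. inverse (s - a) * (taylor_moment s (Suc j) k - \<phi> k)"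
    have "hermite_functional (add_mset a M) ?\<phi>'"
      using Suc.prems \<phi>(1)
      by (intro hermite_functional_scale hermite_functional_diff hermite_functional_taylor_moment)
         simp_all
    moreover have "?\<phi>' (Suc k) - a * ?\<phi>' k = taylor_moment s (Suc j) k" for k
    proof -
      have "?\<phi>' (Suc k) - a * ?\<phi>' k
          = inverse (s - a) * ((taylor_moment s (Suc j) (Suc k) - a * taylor_moment s (Suc j) k)
              - (\<phi> (Suc k) - a * \<phi> k))"
        by (simp add: algebra_simps)
      then show ?thesis using nz by (simp add: taylor_moment_Suc_Suc \<phi>(2))
    qed
    ultimately show ?case by blast
  qed
qed

text \<open>
  The condition on \<open>\<phi> (Suc k)\<close> prescribes the functional on the multiples of \<open>x - a\<close>. These
  have codimension one in \<open>F[x]\<close>, with complement spanned by \<open>1\<close>; adding a multiple of evaluation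
  at \<open>a\<close>, which kills them, adjusts the value at \<open>1\<close>.
\<close>

lemma hermite_functional_lift:
  fixes a :: "'a::field"
  assumes "hermite_functional M \<psi>"
  shows "\<exists>\<phi>. hermite_functional (add_mset a M) \<phi> \<and> \<phi> 0 = 0 \<and>
           (\<forall>k. \<phi> (Suc k) = a * \<phi> k + \<psi> k)"
proof -
  obtain c where c: "\<And>k. \<psi> k = (\<Sum>p\<in>taylor_nodes M. c p * taylor_moment (fst p) (snd p) k)"
    using assms by (auto simp: hermite_functional_def)
  have "\<forall>p\<in>taylor_nodes M. \<exists>\<phi>. hermite_functional (add_mset a M) \<phi> \<and>
          (\<forall>k. \<phi> (Suc k) - a * \<phi> k = taylor_moment (fst p) (snd p) k)"
    using taylor_moment_lift by (auto simp: mem_taylor_nodes)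
  then obtain \<Phi> where \<Phi>: "\<And>p. p \<in> taylor_nodes M \<Longrightarrow> hermite_functional (add_mset a M) (\<Phi> p)"
    "\<And>p k. p \<in> taylor_nodes M \<Longrightarrow>
       \<Phi> p (Suc k) - a * \<Phi> p k = taylor_moment (fst p) (snd p) k"
    by metis
  define \<phi>' where "\<phi>' k = (\<Sum>p\<in>taylor_nodes M. c p * \<Phi> p k)" for k
  have h': "hermite_functional (add_mset a M) \<phi>'"
    unfolding \<phi>'_def using \<Phi>(1) by (intro hermite_functional_sum hermite_functional_scale)
  have rec: "\<phi>' (Suc k) - a * \<phi>' k = \<psi> k" for k
  proof -
    have "\<phi>' (Suc k) - a * \<phi>' k
        = (\<Sum>p\<in>taylor_nodes M. c p * (\<Phi> p (Suc k) - a * \<Phi> p k))"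
      by (simp add: \<phi>'_def sum_distrib_left algebra_simps flip: sum_subtractf)
    then show ?thesis by (simp add: \<Phi>(2) c)
  qed
  have "hermite_functional (add_mset a M) (\<lambda>k. \<phi>' k - \<phi>' 0 * taylor_moment a 0 k)"
    using h' by (intro hermite_functional_diff hermite_functional_scale
        hermite_functional_taylor_moment) simp_all
  moreover have "\<phi>' (Suc k) - \<phi>' 0 * taylor_moment a 0 (Suc k)
      = a * (\<phi>' k - \<phi>' 0 * taylor_moment a 0 k) + \<psi> k" for k
    using rec[of k] by (simp add: taylor_moment_0 algebra_simps)
  ultimately show ?thesis
    by (intro exI[of _ "\<lambda>k. \<phi>' k - \<phi>' 0 * taylor_moment a 0 k"]) (simp add: taylor_moment_0)
qed

text \<open>
  Since \<open>x\<^sup>k\<^sup>+\<^sup>1 = a x\<^sup>k + (x - a) x\<^sup>k\<close>, a lift of the functional for \<open>t\<close> along a new node \<open>a\<close> serves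
  for \<open>t + 1\<close>. The induction starts with an evaluation, for \<open>t = 0\<close>.
\<close>

lemma extracting_functional:
  fixes M :: "'a::field multiset"
  assumes "t < size M"
  shows "\<exists>\<phi>. hermite_functional M \<phi> \<and> (\<forall>k<t. \<phi> k = 0) \<and> \<phi> t = 1"
  using assms
proof (induction M arbitrary: t)
  case empty
  then show ?case by simp
next
  case (add a M)
  show ?case
  proof (cases t)
    case 0
    have "hermite_functional (add_mset a M) (taylor_moment a 0)"
      by (intro hermite_functional_taylor_moment) simp
    with 0 show ?thesis by (auto simp: taylor_moment_0)
  next
    case (Suc t')
    with add.prems add.IH[of t'] obtain \<psi> where
      \<psi>: "hermite_functional M \<psi>" "\<And>k. k < t' \<Longrightarrow> \<psi> k = 0" "\<psi> t' = 1" by auto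
    obtain \<phi> where \<phi>: "hermite_functional (add_mset a M) \<phi>" "\<phi> 0 = 0"
      "\<And>k. \<phi> (Suc k) = a * \<phi> k + \<psi> k"
      using hermite_functional_lift[OF \<psi>(1)] by blast
    have "\<phi> k = 0" if "k \<le> t'" for k
      using that by (induction k) (simp_all add: \<phi> \<psi>)
    with \<phi> \<psi> Suc show ?thesis by (intro exI[of _ \<phi>]) (auto simp: less_Suc_eq_le)
  qed
qed

section \<open>Taylor coefficients of multivariate polynomials\<close>

lemma mvar_plus_mconst_power:
  "(mvar i + mconst a :: ('n, 'a::comm_ring_1) mpoly) ^ k
     = (\<Sum>j\<le>k. Poly_Mapping.single (Poly_Mapping.single i j) (taylor_moment a j k))"
proof -
  have var: "(mvar i :: ('n, 'a) mpoly) ^ j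
      = Poly_Mapping.single (Poly_Mapping.single i j) 1" for j
    by (induction j) (simp_all add: mvar_def mult_single single_add[symmetric])
  have const: "(mconst a :: ('n, 'a) mpoly) ^ j = mconst (a ^ j)" for j
    by (induction j) (simp_all add: mconst_1 mconst_mult)
  have nat: "(of_nat m :: ('n, 'a) mpoly) = mconst (of_nat m)" for m
    by (induction m) (simp_all add: mconst_0 mconst_1 mconst_add)
  have "of_nat (k choose j) * mvar i ^ j * mconst a ^ (k - j)
      = Poly_Mapping.single (Poly_Mapping.single i j) (taylor_moment a j k)" for j
    \<comment> \<open>As a rewrite rule \<open>single_of_nat\<close> would undo the conversion of the constants.\<close>
    unfolding var const nat
    by (simp add: mconst_def mult_single taylor_moment_def del: single_of_nat)
  then show ?thesis by (simp add: binomial_ring)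
qed

text \<open>
  The variables separate, so the coefficient of a product of powers of linear forms, each in its
  own variable, is the product of the univariate coefficients.
\<close>

lemma lookup_shifted_monomial:
  fixes s :: "'n::finite \<Rightarrow> 'a::comm_ring_1"
  shows "mcoeff (shifted_monomial (\<lambda>i. - s i) v) u
     = (\<Prod>i\<in>UNIV. taylor_moment (s i) (Poly_Mapping.lookup u i) (Poly_Mapping.lookup v i))"
proof -
  let ?G = "PiE UNIV (\<lambda>i. {..Poly_Mapping.lookup v i})"
  define mon :: "('n \<Rightarrow> nat) \<Rightarrow> 'n \<Rightarrow>\<^sub>0 nat" where
    "mon g = (\<Sum>i\<in>UNIV. Poly_Mapping.single i (g i))" for g
  define C where "C g = (\<Prod>i\<in>UNIV. taylor_moment (s i) (g i) (Poly_Mapping.lookup v i))" for g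
  have fin: "finite ?G" by (intro finite_PiE) simp_all
  have lookup_mon: "Poly_Mapping.lookup (mon g) = g" for g
    by (rule ext) (simp add: mon_def lookup_sum lookup_single when_def)
  have prod_single: "(\<Prod>i\<in>A. Poly_Mapping.single (Poly_Mapping.single i (g i)) (c i))
      = Poly_Mapping.single (\<Sum>i\<in>A. Poly_Mapping.single i (g i)) (\<Prod>i\<in>A. c i)"
    for A and g :: "'n \<Rightarrow> nat" and c :: "'n \<Rightarrow> 'a"
    by (induction A rule: infinite_finite_induct) (simp_all add: mult_single)
  have "shifted_monomial (\<lambda>i. - s i) v
      = (\<Prod>i\<in>UNIV. \<Sum>j\<le>Poly_Mapping.lookup v i. Poly_Mapping.single (Poly_Mapping.single i j)
          (taylor_moment (s i) j (Poly_Mapping.lookup v i)))"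
    by (simp add: shifted_monomial_def mconst_uminus mvar_plus_mconst_power)
  also have "\<dots> = (\<Sum>g\<in>?G. Poly_Mapping.single (mon g) (C g))"
    by (simp add: prod_sum_PiE prod_single mon_def C_def)
  finally have "mcoeff (shifted_monomial (\<lambda>i. - s i) v) u
      = (\<Sum>g\<in>?G. if mon g = u then C g else 0)"
    by (simp add: lookup_sum lookup_single when_def)
  also have "\<dots> = (\<Sum>g\<in>?G. if g = Poly_Mapping.lookup u then C g else 0)"
  proof -
    have "mon g = u \<longleftrightarrow> g = Poly_Mapping.lookup u" for g
      using lookup_mon by (metis poly_mapping_eqI)
    then show ?thesis by simp
  qed
  also have "\<dots> = (if Poly_Mapping.lookup u \<in> ?G then C (Poly_Mapping.lookup u) else 0)"
    using fin by simp
  also have "\<dots> = C (Poly_Mapping.lookup u)"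
  proof (cases "Poly_Mapping.lookup u \<in> ?G")
    case False
    then obtain i where "Poly_Mapping.lookup v i < Poly_Mapping.lookup u i"
      by (meson PiE_I UNIV_I atMost_iff not_le)
    then have "taylor_moment (s i) (Poly_Mapping.lookup u i) (Poly_Mapping.lookup v i) = 0"
      by (simp add: taylor_moment_def binomial_eq_0)
    then have "C (Poly_Mapping.lookup u) = 0"
      unfolding C_def by (intro prod_zero) auto
    with False show ?thesis by simp
  qed simp
  finally show ?thesis by (simp add: C_def)
qed

text \<open>
  The coefficients of the expansion at \<open>s\<close> are the ordinary coefficients of \<open>f(x + s)\<close>, and
  \<open>f(x + s)\<close> is obtained by replacing each monomial of \<open>f\<close> with one shifted by \<open>- s\<close>.
\<close>

lemma shifted_coeff_expand:
  fixes f :: "('n::finite, 'a::comm_ring_1) mpoly"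
  shows "shifted_coeff f s u = (\<Sum>v\<in>Poly_Mapping.keys f. mcoeff f v *
     (\<Prod>i\<in>UNIV. taylor_moment (s i) (Poly_Mapping.lookup u i) (Poly_Mapping.lookup v i)))"
proof -
  have lookup_scale: "mcoeff (mconst b * p) u = b * mcoeff p u" for b and p :: "('n, 'a) mpoly"
  proof -
    have "mconst b * p = (\<Sum>v\<in>Poly_Mapping.keys p. Poly_Mapping.single v (b * mcoeff p v))"
      by (subst mpoly_eq_sum_single[of p]) (simp add: mconst_def sum_distrib_left mult_single)
    then show ?thesis
      by (simp add: lookup_sum lookup_single when_def in_keys_iff)
  qed
  have "f = shifted_sum s (shifted_sum (\<lambda>i. - s i) f)"
    using shifted_sum_inverse[of "\<lambda>i. - s i" f] by simp
  then have "shifted_coeff f s = Poly_Mapping.lookup (shifted_sum (\<lambda>i. - s i) f)"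
    by (metis shifted_coeff_eq)
  then show ?thesis
    by (simp add: shifted_sum_def lookup_sum lookup_scale lookup_shifted_monomial)
qed

lemma sum_exponents_le_total_degree:
  assumes "v \<in> Poly_Mapping.keys f"
  shows "(\<Sum>i\<in>UNIV. Poly_Mapping.lookup v i) \<le> total_degree f"
  unfolding total_degree_def using assms by (intro Max_ge) auto

section \<open>The Nullstellensatz with multiplicity\<close>

theorem theorem6:
  fixes f :: "('n::finite, 'a::field) mpoly"
    and t :: "'n \<Rightarrow>\<^sub>0 nat"
    and S :: "'n \<Rightarrow> 'a multiset"
  assumes "total_degree f = (\<Sum>i\<in>UNIV. Poly_Mapping.lookup t i)"
    and "mcoeff f t \<noteq> 0"
    and "\<And>i. size (S i) > Poly_Mapping.lookup t i"
  shows "f \<notin> (\<Inter>s \<in> (\<Pi> i\<in>UNIV. set_mset (S i)). vanishing_ideal s (\<lambda>i. count (S i) (s i)))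
    \<and> (\<exists>s \<in> (\<Pi> i\<in>UNIV. set_mset (S i)). \<exists>u.
         (\<forall>i. Poly_Mapping.lookup u i < count (S i) (s i)) \<and> shifted_coeff f s u \<noteq> 0)"
proof -
  let ?L = "Poly_Mapping.lookup"
  let ?K = "Poly_Mapping.keys f"
  obtain \<phi> where \<phi>: "\<And>i. hermite_functional (S i) (\<phi> i)"
    "\<And>i k. k < ?L t i \<Longrightarrow> \<phi> i k = 0" "\<And>i. \<phi> i (?L t i) = 1"
    using extracting_functional[OF assms(3)] by metis
  then have "\<forall>i. \<exists>c. \<forall>k. \<phi> i k
      = (\<Sum>p\<in>taylor_nodes (S i). c p * taylor_moment (fst p) (snd p) k)"
    by (simp add: hermite_functional_def)
  from choice[OF this] obtain c where c: "\<And>i k. \<phi> i k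
      = (\<Sum>p\<in>taylor_nodes (S i). c i p * taylor_moment (fst p) (snd p) k)"
    by blast
  let ?P = "PiE UNIV (\<lambda>i. taylor_nodes (S i))"
  define point :: "('n \<Rightarrow> 'a \<times> nat) \<Rightarrow> 'n \<Rightarrow> 'a" where "point g = (\<lambda>i. fst (g i))" for g
  define order :: "('n \<Rightarrow> 'a \<times> nat) \<Rightarrow> 'n \<Rightarrow>\<^sub>0 nat" where
    "order g = (\<Sum>i\<in>UNIV. Poly_Mapping.single i (snd (g i)))" for g
  have lookup_order: "?L (order g) i = snd (g i)" for g i
    by (simp add: order_def lookup_sum lookup_single when_def)

  have other: "(\<Prod>i\<in>UNIV. \<phi> i (?L v i)) = 0" if "v \<in> ?K" "v \<noteq> t" for v
  proof -
    have "\<exists>i. ?L v i < ?L t i"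
    proof (rule ccontr)
      assume "\<not> ?thesis"
      then have le: "?L t i \<le> ?L v i" for i by (simp add: not_less)
      moreover obtain i where "?L t i \<noteq> ?L v i" using \<open>v \<noteq> t\<close> by (metis poly_mapping_eqI)
      ultimately have "(\<Sum>i\<in>UNIV. ?L t i) < (\<Sum>i\<in>UNIV. ?L v i)"
        by (intro sum_strict_mono_ex1) (auto simp: order.strict_iff_order)
      with sum_exponents_le_total_degree[OF \<open>v \<in> ?K\<close>] assms(1) show False by simp
    qed
    then show ?thesis using \<phi>(2) by (intro prod_zero) auto
  qed
  \<comment> \<open>The value at \<open>f\<close> of the tensor product of the functionals, computed in two ways.\<close>
  have "mcoeff f t = (\<Sum>v\<in>?K. if v = t then mcoeff f v else 0)"
    using assms(2) by (simp add: in_keys_iff)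
  also have "\<dots> = (\<Sum>v\<in>?K. mcoeff f v * (\<Prod>i\<in>UNIV. \<phi> i (?L v i)))"
    by (intro sum.cong) (auto simp: other \<phi>(3))
  also have "\<dots> = (\<Sum>v\<in>?K. \<Sum>g\<in>?P. mcoeff f v *
      ((\<Prod>i\<in>UNIV. c i (g i)) * (\<Prod>i\<in>UNIV. taylor_moment (fst (g i)) (snd (g i)) (?L v i))))"
    by (simp add: c prod_sum_PiE prod.distrib sum_distrib_left)
  also have "\<dots> = (\<Sum>g\<in>?P. (\<Prod>i\<in>UNIV. c i (g i)) * shifted_coeff f (point g) (order g))"
    by (subst sum.swap)
       (simp add: shifted_coeff_expand lookup_order point_def sum_distrib_left mult_ac)
  finally have "(\<Sum>g\<in>?P. (\<Prod>i\<in>UNIV. c i (g i)) * shifted_coeff f (point g) (order g)) \<noteq> 0"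
    using assms(2) by simp
  then obtain g where "g \<in> ?P"
    "(\<Prod>i\<in>UNIV. c i (g i)) * shifted_coeff f (point g) (order g) \<noteq> 0"
    by (rule sum.not_neutral_contains_not_neutral)
  then have g: "g \<in> ?P" "shifted_coeff f (point g) (order g) \<noteq> 0" by auto
  have lt: "?L (order g) i < count (S i) (point g i)" for i
    using g(1) mem_taylor_nodes[of "fst (g i)" "snd (g i)" "S i"]
    by (auto simp: lookup_order point_def PiE_iff)
  then have "point g i \<in># S i" for i
    by (metis count_greater_zero_iff gr_zeroI not_less0)
  then have "point g \<in> (\<Pi> i\<in>UNIV. set_mset (S i))" by simp
  with lt g(2) show ?thesis unfolding vanishing_ideal_def by blast
qed

end
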